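(* For every integer $n\ge 0$, the following identity of polynomials in $x$ holds: \[ H_{n}(x)=\sum_{k=0}^{n}\left( \left(2^{k+2}k+2^{k+1}\right)\sum_{\substack{0\le j\le n\\ j-k\equiv 0 \pmod 2}}\frac{2^{j}\binom{n}{j}\,j!\left(\frac{j+k+2}{2}\right)!}{(j+k+2)!\left(\frac{j-k}{2}\right)!}\,H_{n-j}\right)P_{k}(x). \]
   Context: $P_k(x)$ denotes the $k$-th Legendre polynomial, defined by $\frac{1}{\sqrt{1-2xt+t^2}}=\sum_{k\ge 0}P_k(x)t^k$ (equivalently $P_k(x)=\frac{1}{k!2^k}\frac{d^k}{dx^k}(x^2-1)^k$). The Hermite polynomials $H_n(x)$ are defined by $e^{2xt-t^2}=\sum_{n\ge 0}H_n(x)\frac{t^n}{n!}$, and $H_m:=H_m(0)$ denotes the $m$-th Hermite number. Convention: terms in the inner sum with $j<k$ are taken to be $0$, i.e. $1/m!=0$ for negative integers $m$. *)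

theory Defs
  imports "HOL-Complex_Analysis.Laurent_Convergence"
begin

text \<open>
  The Legendre and Hermite polynomials are defined through their generating functions, read as
  formal power series in \<open>t\<close> (the variable \<open>fps_X\<close>) whose coefficients are real polynomials
  in \<open>x\<close> (the polynomial \<open>[:0, 1:]\<close>).  As \<open>t\<^sup>2 - 2 x t\<close> and \<open>2 x t - t\<^sup>2\<close> have no constant
  term, the binomial series for \<open>(1 + u)\<close> to the power \<open>-1/2\<close> and the exponential series can
  be composed with them.
\<close>

definition legendre_gf :: "real poly fps" where
  "legendre_gf =
     Abs_fps (\<lambda>m. [: (- 1 / 2) gchoose m :]) oo (fps_X ^ 2 - fps_const [:0, 2:] * fps_X)"

definition legendre_poly :: "nat \<Rightarrow> real poly" where
  "legendre_poly k = fps_nth legendre_gf k"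

definition hermite_gf :: "real poly fps" where
  "hermite_gf =
     Abs_fps (\<lambda>m. [: 1 / fact m :]) oo (fps_const [:0, 2:] * fps_X - fps_X ^ 2)"

definition hermite_poly :: "nat \<Rightarrow> real poly" where
  "hermite_poly n = smult (fact n) (fps_nth hermite_gf n)"

definition hermite_number :: "nat \<Rightarrow> real" where
  "hermite_number m = poly (hermite_poly m) 0"

definition inv_fact :: "int \<Rightarrow> real" where
  "inv_fact m = (if m < 0 then 0 else 1 / fact (nat m))"


text \<open>
  For every real \<open>x\<close>, both formal generating functions are the Taylor expansions at \<open>t = 0\<close> of
  the functions they stand for.
\<close>

definition eval_coeffs :: "real \<Rightarrow> real poly fps \<Rightarrow> complex fps" where
  "eval_coeffs x F = Abs_fps (\<lambda>n. complex_of_real (poly (fps_nth F n) x))"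

lemma eval_coeffs_mult: "eval_coeffs x (F * G) = eval_coeffs x F * eval_coeffs x G"
  by (simp add: eval_coeffs_def fps_eq_iff fps_mult_nth poly_sum)

lemma eval_coeffs_1: "eval_coeffs x 1 = 1"
  by (simp add: eval_coeffs_def fps_eq_iff)

lemma eval_coeffs_power: "eval_coeffs x (F ^ n) = eval_coeffs x F ^ n"
  by (induction n) (simp_all add: eval_coeffs_mult eval_coeffs_1)

lemma eval_coeffs_diff: "eval_coeffs x (F - G) = eval_coeffs x F - eval_coeffs x G"
  by (simp add: eval_coeffs_def fps_eq_iff)

lemma eval_coeffs_X: "eval_coeffs x fps_X = fps_X"
  by (simp add: eval_coeffs_def fps_eq_iff)

lemma eval_coeffs_const: "eval_coeffs x (fps_const p) = fps_const (of_real (poly p x))"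
  by (simp add: eval_coeffs_def fps_eq_iff)

lemma eval_coeffs_compose:
  "eval_coeffs x (F oo G) = eval_coeffs x F oo eval_coeffs x G"
proof (rule fps_ext)
  fix n
  have "fps_nth (eval_coeffs x G ^ i) n = of_real (poly (fps_nth (G ^ i) n) x)" for i
    unfolding eval_coeffs_power [symmetric] by (simp add: eval_coeffs_def)
  then show "fps_nth (eval_coeffs x (F oo G)) n = fps_nth (eval_coeffs x F oo eval_coeffs x G) n"
    by (simp add: eval_coeffs_def fps_compose_nth poly_sum)
qed

lemma legendre_poly_generating_function:
  "(\<lambda>t. (1 - 2 * complex_of_real x * t + t ^ 2) powr (- 1 / 2)) has_fps_expansion
     Abs_fps (\<lambda>k. complex_of_real (poly (legendre_poly k) x))"
proof -
  let ?G = "fps_X ^ 2 - fps_const (2 * of_real x) * fps_X :: complex fps"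
  have "of_real (r gchoose m) = (complex_of_real r gchoose m)" for r m
    by (simp add: gbinomial_prod_rev)
  then have bin: "eval_coeffs x (Abs_fps (\<lambda>m. [: (- 1 / 2) gchoose m :])) = fps_binomial (- 1 / 2)"
    by (simp add: eval_coeffs_def fps_eq_iff)
  have "Abs_fps (\<lambda>k. complex_of_real (poly (legendre_poly k) x)) = eval_coeffs x legendre_gf"
    by (simp add: eval_coeffs_def legendre_poly_def)
  also have "\<dots> = fps_binomial (- 1 / 2) oo ?G"
    by (simp add: legendre_gf_def eval_coeffs_compose bin [simplified] eval_coeffs_diff eval_coeffs_mult
        eval_coeffs_power eval_coeffs_X eval_coeffs_const mult.commute)
  finally have eq: "Abs_fps (\<lambda>k. complex_of_real (poly (legendre_poly k) x)) = \<dots>" .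
  have "((\<lambda>u. (1 + u) powr (- 1 / 2)) \<circ> (\<lambda>t. t ^ 2 - 2 * complex_of_real x * t))
          has_fps_expansion (fps_binomial (- 1 / 2) oo ?G)"
    by (rule has_fps_expansion_compose) (auto intro!: fps_expansion_intros)
  then show ?thesis
    unfolding eq by (simp add: o_def algebra_simps)
qed

lemma hermite_poly_generating_function:
  "(\<lambda>t. exp (2 * complex_of_real x * t - t ^ 2)) has_fps_expansion
     Abs_fps (\<lambda>n. complex_of_real (poly (hermite_poly n) x) / fact n)"
proof -
  let ?G = "fps_const (2 * of_real x) * fps_X - fps_X ^ 2 :: complex fps"
  have ex: "eval_coeffs x (Abs_fps (\<lambda>m. [: 1 / fact m :])) = fps_exp 1"
    by (simp add: eval_coeffs_def fps_eq_iff)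
  have "Abs_fps (\<lambda>n. complex_of_real (poly (hermite_poly n) x) / fact n) = eval_coeffs x hermite_gf"
    by (simp add: eval_coeffs_def hermite_poly_def)
  also have "\<dots> = fps_exp 1 oo ?G"
    by (simp add: hermite_gf_def eval_coeffs_compose ex eval_coeffs_diff eval_coeffs_mult
        eval_coeffs_power eval_coeffs_X eval_coeffs_const mult.commute)
  finally have eq: "Abs_fps (\<lambda>n. complex_of_real (poly (hermite_poly n) x) / fact n) = \<dots>" .
  have "((\<lambda>u. exp (1 * u)) \<circ> (\<lambda>t. 2 * complex_of_real x * t - t ^ 2))
          has_fps_expansion (fps_exp 1 oo ?G)"
    by (rule has_fps_expansion_compose) (auto intro!: fps_expansion_intros)
  then show ?thesis
    unfolding eq by (simp add: o_def)
qed

end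

theory Submission
  imports Defs
begin

text \<open>
  Writing \<open>j = k + 2 r\<close>, the classical expansion of \<open>x\<^sup>j\<close> in Legendre polynomials has the coefficient
  \<open>(2 k + 1) j! / (2\<^sup>r r! (j + k + 1)!!)\<close> at \<open>P\<^sub>k\<close>.  It follows by induction on \<open>j\<close>
  from the three-term recurrence, which is read off a differential equation of the
  generating function.  In the same way the generating function of the Hermite polynomials yields
  \<open>H\<^sub>n' = 2 n H\<^sub>n\<^sub>-\<^sub>1\<close>, so that \<open>H\<^sub>n\<close> has the coefficient \<open>2\<^sup>j (n choose j) H\<^sub>n\<^sub>-\<^sub>j(0)\<close>
  at \<open>x\<^sup>j\<close>.  Substituting the first expansion into the second gives the identity.
\<close>

section \<open>Three-term recurrence of the Legendre polynomials\<close>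

text \<open>The binomial series \<open>?B\<close> of (1 + u)^(-1/2) satisfies (1 + u) B' = -B/2;
  substituting u = t^2 - 2xt and applying the chain rule gives the equation.\<close>

lemma legendre_gf_deriv:
  "fps_deriv legendre_gf * (1 + (fps_X ^ 2 - fps_const [:0, 2:] * fps_X)) =
     fps_const [:- 1 / 2:] * legendre_gf * (fps_const 2 * fps_X - fps_const [:0, 2:])"
proof -
  let ?B = "Abs_fps (\<lambda>m. [: (- 1 / 2 :: real) gchoose m :])"
  let ?u = "fps_X ^ 2 - fps_const [:0, 2:] * fps_X :: real poly fps"
  have B: "fps_deriv ?B * (1 + fps_X) = fps_const [:- 1 / 2:] * ?B"
  proof (rule fps_ext)
    fix m
    have "(1 + real m) * ((- 1 / 2) gchoose Suc m) = (- 1 / 2 - real m) * ((- 1 / 2) gchoose m)"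
      using gbinomial_absorb_comp[of "- 1 / 2 :: real" m] gbinomial_absorption[of m "- 1 / 2 :: real"]
      by (simp add: algebra_simps)
    then show "fps_nth (fps_deriv ?B * (1 + fps_X)) m = fps_nth (fps_const [:- 1 / 2:] * ?B) m"
      by (cases m) (simp_all add: distrib_left of_nat_poly algebra_simps)
  qed
  have u0: "fps_nth ?u 0 = 0"
    by (simp add: power2_eq_square)
  have "fps_deriv legendre_gf * (1 + ?u) = ((fps_deriv ?B * (1 + fps_X)) oo ?u) * fps_deriv ?u"
    unfolding legendre_gf_def fps_compose_deriv[OF u0] fps_compose_mult_distrib[OF u0]
    by (simp add: fps_compose_add_distrib fps_X_fps_compose_startby0[OF u0] mult_ac)
  also have "\<dots> = fps_const [:- 1 / 2:] * legendre_gf * fps_deriv ?u"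
    unfolding B fps_compose_mult_distrib[OF u0] by (simp add: legendre_gf_def)
  also have "fps_deriv ?u = fps_const 2 * fps_X - fps_const [:0, 2:]"
    by (simp add: fps_deriv_power numeral_fps_const)
  finally show ?thesis .
qed

lemma poly_legendre_0 [simp]: "poly (legendre_poly 0) x = 1"
  by (simp add: legendre_poly_def legendre_gf_def)

lemma poly_legendre_rec:
  "(2 * real k + 1) * x * poly (legendre_poly k) x =
     real (k + 1) * poly (legendre_poly (k + 1)) x + real k * poly (legendre_poly (k - 1)) x"
proof -
  let ?D = "fps_deriv legendre_gf"
  \<comment> \<open>With every \<open>fps_X\<close> moved to the left, taking the coefficient of t^k
    is a mere index shift. The truncated \<open>k - 1\<close> at k = 0 is harmless because of the
    factor k.\<close>
  have "?D + fps_X * (fps_X * ?D) - fps_const [:0, 2:] * (fps_X * ?D) =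
      fps_const [:- 1 / 2:] * (fps_const 2 * (fps_X * legendre_gf) - fps_const [:0, 2:] * legendre_gf)"
    using legendre_gf_deriv
    by (simp only: power2_eq_square distrib_left right_diff_distrib mult_1_right mult_1_left
        mult_ac add_diff_eq)
  then have "poly (fps_nth (?D + fps_X * (fps_X * ?D) - fps_const [:0, 2:] * (fps_X * ?D)) k) x =
      poly (fps_nth (fps_const [:- 1 / 2:] *
        (fps_const 2 * (fps_X * legendre_gf) - fps_const [:0, 2:] * legendre_gf)) k) x"
    by simp
  then show ?thesis
    unfolding fps_add_nth fps_sub_nth fps_mult_left_const_nth fps_X_mult_nth fps_deriv_nth
    by (cases k; cases "k - 1") (simp_all add: legendre_poly_def algebra_simps)
qed

section \<open>Derivative and coefficients of the Hermite polynomials\<close>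

lemma hermite_gf_deriv:
  "fps_deriv hermite_gf = hermite_gf * (fps_const [:0, 2:] - fps_const 2 * fps_X)"
proof -
  let ?E = "Abs_fps (\<lambda>m. [: 1 / fact m :: real:])"
  let ?u = "fps_const [:0, 2:] * fps_X - fps_X ^ 2 :: real poly fps"
  have E: "fps_deriv ?E = ?E"
    by (rule fps_ext) (simp add: of_nat_poly del: of_nat_Suc)
  have u0: "fps_nth ?u 0 = 0"
    by (simp add: power2_eq_square)
  have "fps_deriv hermite_gf = hermite_gf * fps_deriv ?u"
    unfolding hermite_gf_def fps_compose_deriv[OF u0] E ..
  also have "fps_deriv ?u = fps_const [:0, 2:] - fps_const 2 * fps_X"
    by (simp add: fps_deriv_power numeral_fps_const)
  finally show ?thesis .
qed

lemma hermite_poly_0: "hermite_poly 0 = 1"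
  by (simp add: hermite_poly_def hermite_gf_def)

lemma hermite_poly_Suc:
  "hermite_poly (Suc n) = [:0, 2:] * hermite_poly n - smult (2 * real n) (hermite_poly (n - 1))"
proof -
  have "fps_deriv hermite_gf = fps_const [:0, 2:] * hermite_gf - fps_const 2 * (fps_X * hermite_gf)"
    using hermite_gf_deriv by (simp only: right_diff_distrib mult_ac)
  then have "fps_nth (fps_deriv hermite_gf) n =
      fps_nth (fps_const [:0, 2:] * hermite_gf - fps_const 2 * (fps_X * hermite_gf)) n"
    by simp
  then have "smult (1 + real n) (fps_nth hermite_gf (Suc n)) =
      [:0, 2:] * fps_nth hermite_gf n - (if n = 0 then 0 else smult 2 (fps_nth hermite_gf (n - 1)))"
    unfolding fps_sub_nth fps_mult_left_const_nth fps_X_mult_nth fps_deriv_nth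
    by (simp add: of_nat_poly numeral_poly)
  then have "smult (fact n) (smult (1 + real n) (fps_nth hermite_gf (Suc n))) =
      smult (fact n) ([:0, 2:] * fps_nth hermite_gf n -
        (if n = 0 then 0 else smult 2 (fps_nth hermite_gf (n - 1))))"
    by (rule arg_cong)
  then show ?thesis
    by (cases n) (simp_all add: hermite_poly_def smult_diff_right algebra_simps)
qed

text \<open>Differentiate the recurrence in x and use the claim for the two preceding indices. What
  is then multiplied by 2m is the recurrence for \<open>hermite_poly m\<close> when m > 0, which
  leaves (2 + 2m) \<open>hermite_poly m\<close>; for m = 0 the factor is zero.\<close>

lemma pderiv_hermite_poly: "pderiv (hermite_poly n) = smult (2 * real n) (hermite_poly (n - 1))"
proof (induction n rule: less_induct)
  case (less n)
  show ?case
  proof (cases n)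
    case 0
    then show ?thesis by (simp add: hermite_poly_0)
  next
    case (Suc m)
    have "pderiv (hermite_poly n) = smult 2 (hermite_poly m) +
        smult (2 * real m) ([:0, 2:] * hermite_poly (m - 1) -
          smult (2 * real (m - 1)) (hermite_poly (m - 1 - 1)))"
      using less[of m] less[of "m - 1"] Suc
      by (simp add: hermite_poly_Suc pderiv_diff pderiv_mult pderiv_smult pderiv_pCons
          smult_diff_right algebra_simps)
    also have "\<dots> = smult (2 * real n) (hermite_poly m)"
    proof (cases m)
      case 0
      then show ?thesis using Suc by simp
    next
      case (Suc l)
      have "smult 2 p + smult (2 * real m) p = smult (2 * real n) p" for p :: "real poly"
        using \<open>n = Suc m\<close> by (simp add: smult_add_left[symmetric])
      then show ?thesis
        using hermite_poly_Suc[of l] Suc by simp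
    qed
    finally show ?thesis using Suc by simp
  qed
qed

text \<open>Comparing coefficients in \<open>pderiv_hermite_poly\<close> lowers n and j together,
  down to the constant term, which is a Hermite number.\<close>

lemma coeff_hermite_poly:
  "coeff (hermite_poly n) j = 2 ^ j * real (n choose j) * hermite_number (n - j)"
proof (induction j arbitrary: n)
  case 0
  show ?case by (simp add: hermite_number_def poly_0_coeff_0)
next
  case (Suc j)
  show ?case
  proof (cases n)
    case 0
    then show ?thesis by (simp add: hermite_poly_0)
  next
    case n: (Suc m)
    have "real (Suc j) * coeff (hermite_poly n) (Suc j) = 2 * real n * coeff (hermite_poly m) j"
      using coeff_pderiv[of "hermite_poly n" j] n by (simp add: pderiv_hermite_poly)
    also have "\<dots> = 2 ^ Suc j * (real (Suc m) * real (m choose j)) * hermite_number (m - j)"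
      using n by (simp add: Suc.IH)
    also have "real (Suc m) * real (m choose j) = real (Suc j) * real (Suc m choose Suc j)"
      by (metis Suc_times_binomial_eq of_nat_mult mult.commute)
    finally show ?thesis using n by simp
  qed
qed

lemma degree_hermite_poly_le: "degree (hermite_poly n) \<le> n"
  by (rule degree_le) (simp add: coeff_hermite_poly)

lemma poly_hermite:
  "poly (hermite_poly n) x =
     (\<Sum>j\<le>n. 2 ^ j * real (n choose j) * hermite_number (n - j) * x ^ j)"
  unfolding poly_altdef coeff_hermite_poly[symmetric]
  by (rule sum.mono_neutral_left) (auto simp: degree_hermite_poly_le coeff_eq_0
      intro: order.trans[OF _ degree_hermite_poly_le])

section \<open>Legendre expansion of monomials\<close>

text \<open>Half the integral of x^j P_k(x) over [-1, 1], in closed form. The normalising factor 2k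
  + 1 of the expansion is kept outside.\<close>

definition monomial_legendre_coeff :: "nat \<Rightarrow> nat \<Rightarrow> real" where
  "monomial_legendre_coeff j k =
     (if even (int j - int k)
      then 2 ^ (k + 1) * fact j * fact ((j + k + 2) div 2) / fact (j + k + 2)
        * inv_fact ((int j - int k) div 2)
      else 0)"

lemma monomial_legendre_coeff_eq_0: "j < k \<Longrightarrow> monomial_legendre_coeff j k = 0"
  by (auto simp: monomial_legendre_coeff_def inv_fact_def)

lemma monomial_legendre_coeff_add:
  "monomial_legendre_coeff (k + 2 * r) k =
     2 ^ (k + 1) * fact (k + 2 * r) * fact (k + r + 1) / (fact (2 * (k + r + 1)) * fact r)"
proof -
  have "(k + 2 * r + k + 2) div 2 = k + r + 1" "k + 2 * r + k + 2 = 2 * (k + r + 1)" by simp_all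
  then show ?thesis
    by (simp add: monomial_legendre_coeff_def inv_fact_def)
qed

text \<open>This is the three-term recurrence of P_k integrated against x^j, verified here on the
  closed form.\<close>

lemma monomial_legendre_coeff_Suc:
  "(2 * real k + 1) * monomial_legendre_coeff (Suc j) k =
     real k * monomial_legendre_coeff j (k - 1) + real (k + 1) * monomial_legendre_coeff j (k + 1)"
proof (cases "even (Suc j + k) \<and> k \<le> Suc j")
  \<comment> \<open>Either the parity is wrong in every term or k - 1 > j; both sides vanish, with
    the factor k covering k = 0.\<close>
  case False
  then show ?thesis
    by (cases k) (auto simp: monomial_legendre_coeff_def inv_fact_def)
next
  case True
  then obtain r where r: "Suc j = k + 2 * r"
    by (metis dvdE even_diff_nat le_add_diff_inverse add.commute not_less)
  show ?thesis
  proof (cases r)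
    case 0
    then obtain l where l: "k = Suc l" "j = l" using r by (cases k) auto
    have "monomial_legendre_coeff j (k + 1) = 0"
      using l by (simp add: monomial_legendre_coeff_eq_0)
    define A :: real where "A = fact (2 * k)"
    have A: "A > 0" "fact (2 * (k + 1)) = 2 * (real k + 1) * (2 * real k + 1) * A"
      by (simp_all add: A_def algebra_simps)
    have "monomial_legendre_coeff (Suc j) k =
        2 ^ (k + 1) * (real k * fact l) * ((real k + 1) * fact k) / fact (2 * (k + 1))"
      using monomial_legendre_coeff_add[of k 0] l by simp
    also have "\<dots> = 2 ^ k * (real k * fact l) * fact k / ((2 * real k + 1) * A)"
      unfolding A(2) using A(1) by (simp add: divide_simps)
    finally have "(2 * real k + 1) * monomial_legendre_coeff (Suc j) k =
        real k * (2 ^ k * fact l * fact k / A)"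
      using A(1) by (simp add: divide_simps mult_ac)
    also have "2 ^ k * fact l * fact k / A = monomial_legendre_coeff j (k - 1)"
      using monomial_legendre_coeff_add[of l 0] l by (simp add: A_def)
    finally show ?thesis
      using \<open>monomial_legendre_coeff j (k + 1) = 0\<close> by simp
  next
    case (Suc s)
    have j: "j = (k + 1) + 2 * s" using r Suc by simp
    define A :: real where "A = fact (2 * (k + s + 1))"
    define B :: real where "B = fact (k + s + 1)"
    \<comment> \<open>The factors p and 2pq raise the factorials \<open>B\<close> and
      \<open>A\<close> by one step. For k > 0, \<open>Y\<close> is the coefficient at k - 1; the
      other two are rational multiples of \<open>Y\<close>, so the claim becomes a polynomial
      identity.\<close>
    define p where "p = real k + real s + 2"
    define q where "q = 2 * (real k + real s) + 3"
    define Y where "Y = 2 ^ k * fact j * B / (A * fact (Suc s))"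
    have pos: "A > 0" "p > 0" "q > 0"
      by (simp_all add: A_def p_def q_def add_nonneg_pos)
    have A: "fact (2 * (k + s + 2)) = 2 * p * q * A" and B: "fact (k + s + 2) = p * B"
      by (simp_all add: A_def B_def p_def q_def algebra_simps)
    have "monomial_legendre_coeff (Suc j) k =
        2 ^ (k + 1) * (real (Suc j) * fact j) * (p * B) / (2 * p * q * A * fact (Suc s))"
      using monomial_legendre_coeff_add[of k r] r Suc unfolding A[symmetric] B[symmetric] by simp
    also have "\<dots> = Y * (real (Suc j) / q)"
      using pos by (simp add: Y_def divide_simps mult_ac)
    finally have c1: "monomial_legendre_coeff (Suc j) k = Y * (real (Suc j) / q)" .
    have "monomial_legendre_coeff j (k + 1) =
        2 ^ (k + 2) * fact j * (p * B) / (2 * p * q * A * fact s)"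
      using monomial_legendre_coeff_add[of "k + 1" s] j unfolding A[symmetric] B[symmetric] by simp
    also have "\<dots> = Y * (2 * real (Suc s) / q)"
      using pos by (simp add: Y_def divide_simps mult_ac)
    finally have c2: "monomial_legendre_coeff j (k + 1) = Y * (2 * real (Suc s) / q)" .
    have c3: "real k * monomial_legendre_coeff j (k - 1) = real k * Y"
      using monomial_legendre_coeff_add[of "k - 1" "Suc s"] j
      by (cases k) (simp_all add: Y_def A_def B_def)
    have "(2 * real k + 1) * real (Suc j) = real k * q + real (k + 1) * (2 * real (Suc s))"
      by (simp add: q_def j algebra_simps)
    then have "(2 * real k + 1) * (real (Suc j) / q) =
        real k + real (k + 1) * (2 * real (Suc s) / q)"
      using pos by (simp add: field_simps)
    then have "Y * ((2 * real k + 1) * (real (Suc j) / q)) =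
        Y * (real k + real (k + 1) * (2 * real (Suc s) / q))"
      by simp
    then show ?thesis
      unfolding c1 c2 c3 by (simp only: distrib_left mult_ac)
  qed
qed

lemma monomial_legendre_expansion:
  "x ^ j = (\<Sum>k\<le>j. (2 * real k + 1) * monomial_legendre_coeff j k * poly (legendre_poly k) x)"
proof (induction j)
  case 0
  show ?case by (simp add: monomial_legendre_coeff_def inv_fact_def)
next
  case (Suc j)
  let ?c = monomial_legendre_coeff and ?P = "\<lambda>k. poly (legendre_poly k) x"
  have "x ^ Suc j = (\<Sum>k\<le>j. ?c j k * ((2 * real k + 1) * x * ?P k))"
    by (simp add: Suc.IH sum_distrib_left mult_ac)
  also have "\<dots> = (\<Sum>k\<le>j. real (k + 1) * ?c j k * ?P (k + 1)) + (\<Sum>k\<le>j. real k * ?c j k * ?P (k - 1))"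
    unfolding poly_legendre_rec by (simp add: sum.distrib[symmetric] algebra_simps)
  \<comment> \<open>Both sums are reindexed to collect the terms at the same P_k. Terms at k = 0
    vanish by the factor k, and the second sum is first padded with zero terms k > j so that its
    shifted range matches.\<close>
  also have "(\<Sum>k\<le>j. real (k + 1) * ?c j k * ?P (k + 1)) = (\<Sum>k\<le>Suc j. real k * ?c j (k - 1) * ?P k)"
    by (subst sum.atMost_Suc_shift) simp
  also have "(\<Sum>k\<le>j. real k * ?c j k * ?P (k - 1)) =
      (\<Sum>k\<le>Suc (Suc j). real k * ?c j k * ?P (k - 1))"
    by (simp add: monomial_legendre_coeff_eq_0)
  also have "\<dots> = (\<Sum>k\<le>Suc j. real (k + 1) * ?c j (k + 1) * ?P k)"
    by (subst sum.atMost_Suc_shift) simp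
  finally show ?case
    unfolding monomial_legendre_coeff_Suc by (simp only: sum.distrib[symmetric] distrib_right)
qed

section \<open>Substitution into the Hermite polynomial\<close>

theorem theorem2:
  fixes n :: nat
  shows "hermite_poly n =
    (\<Sum>k = 0..n. smult
       ((2 ^ (k + 2) * real k + 2 ^ (k + 1)) *
        (\<Sum>j | 0 \<le> j \<and> j \<le> n \<and> even (int j - int k).
           2 ^ j * real (n choose j) * fact j * fact ((j + k + 2) div 2) / fact (j + k + 2)
             * inv_fact ((int j - int k) div 2) * hermite_number (n - j)))
       (legendre_poly k))"
proof (rule poly_eq_poly_eq_iff[THEN iffD1], rule ext)
  fix x
  let ?h = "\<lambda>j. 2 ^ j * real (n choose j) * hermite_number (n - j)"
  let ?c = monomial_legendre_coeff and ?P = "\<lambda>k. poly (legendre_poly k) x"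
  let ?S = "\<lambda>k. \<Sum>j | 0 \<le> j \<and> j \<le> n \<and> even (int j - int k).
           2 ^ j * real (n choose j) * fact j * fact ((j + k + 2) div 2) / fact (j + k + 2)
             * inv_fact ((int j - int k) div 2) * hermite_number (n - j)"
  \<comment> \<open>The outer factor is 2^(k+1) (2k + 1), and 2^(k+1) is part of
    \<open>?c j k\<close>.\<close>
  have S: "(2 ^ (k + 2) * real k + 2 ^ (k + 1)) * ?S k =
      (2 * real k + 1) * (\<Sum>j\<le>n. ?h j * ?c j k)" for k
  proof -
    have "(\<Sum>j\<le>n. ?h j * ?c j k) = (\<Sum>j | j \<in> {..n} \<and> even (int j - int k). ?h j * ?c j k)"
      by (rule sum.mono_neutral_right) (auto simp: monomial_legendre_coeff_def)
    also have "\<dots> = 2 ^ (k + 1) * ?S k"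
      unfolding sum_distrib_left
      by (rule sum.cong) (auto simp: monomial_legendre_coeff_def)
    finally show ?thesis by (simp add: algebra_simps)
  qed
  have "poly (hermite_poly n) x = (\<Sum>j\<le>n. ?h j * (\<Sum>k\<le>j. (2 * real k + 1) * ?c j k * ?P k))"
    by (simp only: poly_hermite monomial_legendre_expansion[of x, symmetric])
  \<comment> \<open>Padding with the zero coefficients for k > j makes the range rectangular, so the
    sums can be swapped.\<close>
  also have "\<dots> = (\<Sum>j\<le>n. ?h j * (\<Sum>k\<le>n. (2 * real k + 1) * ?c j k * ?P k))"
    by (intro sum.cong refl arg_cong2[where f = "(*)"] sum.mono_neutral_left)
      (auto simp: monomial_legendre_coeff_eq_0)
  also have "\<dots> = (\<Sum>k\<le>n. (2 * real k + 1) * (\<Sum>j\<le>n. ?h j * ?c j k) * ?P k)"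
    unfolding sum_distrib_left sum_distrib_right by (subst sum.swap) (simp add: mult_ac)
  also have "\<dots> = (\<Sum>k\<le>n. (2 ^ (k + 2) * real k + 2 ^ (k + 1)) * ?S k * ?P k)"
    by (simp only: S)
  also have "\<dots> = poly (\<Sum>k = 0..n. smult ((2 ^ (k + 2) * real k + 2 ^ (k + 1)) * ?S k)
      (legendre_poly k)) x"
    by (simp only: poly_sum poly_smult atLeast0AtMost)
  finally show "poly (hermite_poly n) x = \<dots>" .
qed

end
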